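(* Let $n$ be a positive integer, let $k$ be a nonnegative integer, and let $cw(n,k)$ denote the number of weak compositions of $n$ in which exactly $k$ parts are equal to zero. Then $$cw(n,k)=2^{n-k-1}\sum_{i=0}^k2^i\binom{k+1}{i}\binom{n-1}{k-i}.$$
   Context: A weak composition of $n$ is an ordered sequence of nonnegative integers (parts) whose sum is $n$; parts equal to $0$ are allowed, and the positive parts are unrestricted. The power $2^{n-k-1}$ is a rational number when its exponent is negative, and $\binom{a}{b}=0$ for integers $b>a\geq 0$. *)

theory Defs
  imports Complex_Main
begin

definition weak_compositions :: "nat \<Rightarrow> nat list set" where
  "weak_compositions n = {xs. sum_list xs = n}"

definition cw :: "nat \<Rightarrow> nat \<Rightarrow> nat" where
  "cw n k = card {xs \<in> weak_compositions n. count_list xs 0 = k}"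

text \<open>The set counted by \<open>cw\<close> is finite, so its cardinality is not the default value \<open>0\<close> of
  \<open>card\<close> on infinite sets.\<close>

lemma length_le_count_zero_add_sum_list:
  "length xs \<le> count_list xs 0 + sum_list xs" for xs :: "nat list"
  by (induction xs) auto

lemma finite_weak_compositions_zeros:
  "finite {xs \<in> weak_compositions n. count_list xs 0 = k}"
proof (rule finite_subset)
  show "{xs \<in> weak_compositions n. count_list xs 0 = k}
      \<subseteq> {xs. set xs \<subseteq> {..n} \<and> length xs \<le> k + n}"
    using length_le_count_zero_add_sum_list member_le_sum_list
    by (fastforce simp: weak_compositions_def)
  show "finite {xs :: nat list. set xs \<subseteq> {..n} \<and> length xs \<le> k + n}"
    by (rule finite_lists_length_le) simp
qed

end

(* Let h n k count the compositions in cw n k that begin with a positive part.  Removing a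
   leading 0, removing a leading 1, or decreasing a leading part that exceeds 1 gives
     cw n (k+1) = h n (k+1) + cw n k  and  h (n+1) k = cw n k + h n k,
   and eliminating h leaves
     cw (n+2) (k+1) + cw (n+1) k = cw (n+2) k + 2 cw (n+1) (k+1).
   The sum on the right-hand side is the coefficient of x^k in (1 + 2x)^(k+1) (1 + x)^(n-1), and
   1 + 2x = 2 (1 + x) - 1 shows that it satisfies the corresponding recurrence. *)
theory Submission
  imports Defs "HOL-Computational_Algebra.Polynomial"
begin

definition wc_zeros :: "nat \<Rightarrow> nat \<Rightarrow> nat list set" where
  "wc_zeros n k = {xs. sum_list xs = n \<and> count_list xs 0 = k}"

text \<open>The cardinality of this set is the auxiliary count \<open>h n k\<close>.\<close>

definition wc_zeros_pos :: "nat \<Rightarrow> nat \<Rightarrow> nat list set" where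
  "wc_zeros_pos n k = {xs \<in> wc_zeros n k. xs \<noteq> [] \<and> 0 < hd xs}"

lemma cw_eq_card: "cw n k = card (wc_zeros n k)"
  by (simp add: cw_def wc_zeros_def weak_compositions_def)

lemma finite_wc_zeros [simp]: "finite (wc_zeros n k)"
  using finite_weak_compositions_zeros[of n k]
  by (simp add: wc_zeros_def weak_compositions_def)

lemma finite_wc_zeros_pos [simp]: "finite (wc_zeros_pos n k)"
  by (simp add: wc_zeros_pos_def)

lemma wc_zeros_0: "wc_zeros 0 k = {replicate k 0}"
proof -
  have "xs = replicate (count_list xs 0) 0" if "sum_list xs = 0" for xs :: "nat list"
    using that by (induction xs) auto
  moreover have "count_list (replicate k (0::nat)) 0 = k"
    by (induction k) auto
  ultimately show ?thesis
    by (auto simp: wc_zeros_def)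
qed

lemma cw_0: "cw 0 k = 1"
  by (simp add: cw_eq_card wc_zeros_0)

lemma wc_zeros_pos_0: "wc_zeros_pos 0 k = {}"
  by (auto simp: wc_zeros_pos_def wc_zeros_def neq_Nil_conv)

lemma wc_zeros_Suc_0: "wc_zeros (Suc n) 0 = wc_zeros_pos (Suc n) 0"
proof -
  have "xs \<noteq> [] \<and> 0 < hd xs" if "xs \<in> wc_zeros (Suc n) 0" for xs
    using that by (cases xs) (auto simp: wc_zeros_def split: if_splits)
  then show ?thesis
    by (auto simp: wc_zeros_pos_def)
qed

lemma wc_zeros_Suc_Suc:
  "wc_zeros (Suc n) (Suc k) = Cons 0 ` wc_zeros (Suc n) k \<union> wc_zeros_pos (Suc n) (Suc k)"
proof -
  have "xs \<in> Cons 0 ` wc_zeros (Suc n) k \<union> wc_zeros_pos (Suc n) (Suc k)"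
    if "xs \<in> wc_zeros (Suc n) (Suc k)" for xs
    using that by (cases xs) (auto simp: wc_zeros_def wc_zeros_pos_def split: if_splits)
  moreover have "Cons 0 ` wc_zeros (Suc n) k \<subseteq> wc_zeros (Suc n) (Suc k)"
    by (auto simp: wc_zeros_def)
  ultimately show ?thesis
    by (auto simp: wc_zeros_pos_def)
qed

text \<open>What follows a leading 1 may be empty or begin with 0, so the first image ranges over
  all of \<open>wc_zeros n k\<close>; a head above 1 stays positive when lowered.\<close>

lemma wc_zeros_pos_Suc:
  "wc_zeros_pos (Suc n) k =
     Cons 1 ` wc_zeros n k \<union> (\<lambda>xs. Suc (hd xs) # tl xs) ` wc_zeros_pos n k"
    (is "?L = ?A \<union> ?B")
proof -
  have "xs \<in> ?A \<union> ?B" if xs: "xs \<in> ?L" for xs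
  proof -
    obtain a ys where a: "xs = Suc a # ys"
      using xs by (cases xs; cases "hd xs") (auto simp: wc_zeros_pos_def)
    show ?thesis
    proof (cases a)
      case 0
      then show ?thesis
        using xs a by (auto simp: wc_zeros_def wc_zeros_pos_def)
    next
      case (Suc b)
      then have "a # ys \<in> wc_zeros_pos n k"
        using xs a by (auto simp: wc_zeros_def wc_zeros_pos_def)
      then show ?thesis
        using a by force
    qed
  qed
  moreover have "?A \<union> ?B \<subseteq> ?L"
    by (auto simp: wc_zeros_def wc_zeros_pos_def neq_Nil_conv)
  ultimately show ?thesis
    by blast
qed

lemma cw_Suc_0: "cw (Suc n) 0 = card (wc_zeros_pos (Suc n) 0)"
  by (simp add: cw_eq_card wc_zeros_Suc_0)

lemma cw_Suc_Suc: "cw (Suc n) (Suc k) = cw (Suc n) k + card (wc_zeros_pos (Suc n) (Suc k))"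
  unfolding cw_eq_card wc_zeros_Suc_Suc
  by (subst card_Un_disjoint) (auto simp: card_image wc_zeros_pos_def)

lemma card_wc_zeros_pos_Suc:
  "card (wc_zeros_pos (Suc n) k) = cw n k + card (wc_zeros_pos n k)"
proof -
  have "inj_on (\<lambda>xs. Suc (hd xs) # tl xs) (wc_zeros_pos n k)"
    by (auto simp: inj_on_def wc_zeros_pos_def intro: list.expand)
  then show ?thesis
    unfolding wc_zeros_pos_Suc cw_eq_card
    \<comment> \<open>The heads separate the two images: 1 in the first, at least 2 in the
      second.\<close>
    by (subst card_Un_disjoint) (auto simp: card_image wc_zeros_pos_def)
qed

lemma cw_1: "cw (Suc 0) k = Suc k"
  by (induction k)
    (simp_all add: cw_Suc_0 cw_Suc_Suc card_wc_zeros_pos_Suc wc_zeros_pos_0 cw_0)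

lemma cw_no_zeros_rec: "cw (Suc (Suc n)) 0 = 2 * cw (Suc n) 0"
  by (simp add: cw_Suc_0 card_wc_zeros_pos_Suc[of "Suc n"])

text \<open>\<open>cw_Suc_Suc\<close> at \<open>n\<close> and at \<open>Suc n\<close> expresses both
  values of \<open>h\<close> through \<open>cw\<close>; the additive form avoids truncated
  subtraction.\<close>

lemma cw_rec:
  "cw (Suc (Suc n)) (Suc k) + cw (Suc n) k = cw (Suc (Suc n)) k + 2 * cw (Suc n) (Suc k)"
  using cw_Suc_Suc[of n k]
  by (simp add: cw_Suc_Suc[of "Suc n"] card_wc_zeros_pos_Suc[of "Suc n"])

lemma coeff_one_linear_power:
  fixes b :: "'a :: comm_semiring_1"
  shows "coeff ([:1, b:] ^ n) i = of_nat (n choose i) * b ^ i"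
proof (cases "i \<le> n")
  case True
  then show ?thesis
    by (simp add: coeff_linear_poly_power)
next
  case False
  \<comment> \<open>Beyond the degree both sides vanish.\<close>
  have "degree ([:1, b:] ^ n) \<le> n"
    using degree_power_le[of "[:1, b:]" n] by (simp split: if_splits)
  with False show ?thesis
    by (simp add: coeff_eq_0 binomial_eq_0)
qed

text \<open>The exponent \<open>a\<close> is kept independent of \<open>k\<close>, although only
  \<open>a = k + 1\<close> occurs in the final formula: the recurrences below change one without the
  other.\<close>

definition binom_conv :: "nat \<Rightarrow> nat \<Rightarrow> nat \<Rightarrow> rat" where
  "binom_conv a m k = coeff ([:1, 2:] ^ a * [:1, 1:] ^ m) k"

lemma binom_conv_eq_sum:
  "binom_conv a m k = (\<Sum>i=0..k. 2 ^ i * of_nat (a choose i) * of_nat (m choose (k - i)))"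
  unfolding binom_conv_def coeff_mult coeff_one_linear_power atMost_atLeast0
  by (simp add: mult.commute)

lemma binom_conv_Suc_right:
  "binom_conv a (Suc m) (Suc k) = binom_conv a m (Suc k) + binom_conv a m k"
proof -
  have "[:1, 2:] ^ a * [:1, 1:] ^ Suc m
      = [:1, 2:] ^ a * [:1, 1:] ^ m + pCons 0 ([:1, 2::rat:] ^ a * [:1, 1:] ^ m)"
    by (simp add: algebra_simps)
  then show ?thesis
    by (simp add: binom_conv_def)
qed

lemma binom_conv_Suc_left:
  "binom_conv (Suc a) m k = 2 * binom_conv a (Suc m) k - binom_conv a m k"
proof -
  have "[:1, 2:] ^ Suc a * [:1, 1:] ^ m
      = smult 2 ([:1, 2:] ^ a * [:1, 1:] ^ Suc m) - [:1, 2::rat:] ^ a * [:1, 1:] ^ m"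
    by (simp add: algebra_simps smult_add_right numeral_poly)
  then show ?thesis
    by (simp only: binom_conv_def coeff_smult coeff_diff)
qed

text \<open>Splitting off a factor 1 + x produces \<open>binom_conv (Suc (Suc k)) m k\<close>, which
  is off the diagonal \<open>a = k + 1\<close>; lowering its first exponent brings it back.\<close>

lemma binom_conv_diag_rec:
  "binom_conv (Suc (Suc k)) (Suc m) (Suc k) =
     2 * binom_conv (Suc k) (Suc m) k - binom_conv (Suc k) m k
     + binom_conv (Suc (Suc k)) m (Suc k)"
  by (simp only: binom_conv_Suc_right binom_conv_Suc_left[of "Suc k" m k])

lemma binom_conv_0_middle: "binom_conv a 0 k = 2 ^ k * of_nat (a choose k)"
  by (simp add: binom_conv_def coeff_one_linear_power)

lemma binom_conv_0_right: "binom_conv a m 0 = 1"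
  by (simp add: binom_conv_eq_sum)

text \<open>The factor \<open>2 ^ k\<close> on the left avoids negative exponents. The induction on
  \<open>k\<close> is nested in that on \<open>m\<close> because \<open>cw_rec\<close> uses the
  preceding \<open>k\<close> in the same row and two entries of the row before.\<close>

lemma cw_Suc_eq_binom_conv: "2 ^ k * of_nat (cw (Suc m) k) = 2 ^ m * binom_conv (Suc k) m k"
proof (induction m arbitrary: k)
  case 0
  then show ?case
    by (simp add: cw_1 binom_conv_0_middle)
next
  case (Suc m)
  note IH = Suc
  show ?case
  proof (induction k)
    case 0
    then show ?case
      using IH[of 0] by (simp add: cw_no_zeros_rec binom_conv_0_right)
  next
    case (Suc k)
    have "of_nat (cw (Suc (Suc m)) (Suc k))
        = of_nat (cw (Suc (Suc m)) k) + 2 * of_nat (cw (Suc m) (Suc k))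
          - (of_nat (cw (Suc m) k) :: rat)"
      using arg_cong[OF cw_rec[of m k], of "of_nat :: nat \<Rightarrow> rat"] by (simp add: eq_diff_eq)
    \<comment> \<open>Each value of \<open>cw\<close> is grouped with the power of 2 that its
      induction hypothesis requires.\<close>
    then have "2 ^ Suc k * of_nat (cw (Suc (Suc m)) (Suc k))
        = 2 * (2 ^ k * of_nat (cw (Suc (Suc m)) k)) + 2 * (2 ^ Suc k * of_nat (cw (Suc m) (Suc k)))
          - 2 * (2 ^ k * of_nat (cw (Suc m) k) :: rat)"
      by (simp only:) (simp add: algebra_simps)
    also have "\<dots> = 2 ^ Suc m * binom_conv (Suc (Suc k)) (Suc m) (Suc k)"
      unfolding Suc IH binom_conv_diag_rec by (simp add: algebra_simps)
    finally show ?case .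
  qed
qed

theorem theorem10:
  fixes n k :: nat
  assumes "n \<ge> 1"
  shows "(of_nat (cw n k) :: rat) =
    2 powi (int n - int k - 1) *
    (\<Sum>i=0..k. 2 ^ i * of_nat ((k + 1) choose i) * of_nat ((n - 1) choose (k - i)))"
proof -
  obtain m where m: "n = Suc m"
    using assms by (cases n) auto
  have "(2::rat) powi (int n - int k - 1) = 2 ^ m / 2 ^ k"
    by (simp add: m power_int_diff)
  moreover have "of_nat (cw n k) = 2 ^ m / 2 ^ k * binom_conv (k + 1) (n - 1) k"
    using cw_Suc_eq_binom_conv[of k m] by (simp add: m field_simps)
  ultimately show ?thesis
    by (simp only: binom_conv_eq_sum)
qed

end
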